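(* Assume that there exist four or more (pairwise distinct) states $x_0,x_1^1,\dots,x_1^n,x_2\in\mathcal{X}$, $n\in\mathbb{N}$, such that $\mathcal{X}^s=\{x_0\}$, $\mathcal{X}^m=\{x_1^1,\dots,x_1^n,x_2\}$, and $H(x_2)>H(x_1^r)$, $H(x_1^r)=H(x_1^q)$, $\Phi(x_1^r,x_1^q)-H(x_1^r)<\Gamma_m$ for every $r,q=1,\dots,n$. Then for every $r=1,\dots,n$ the set $\{x_0,x_1^r,x_2\}\subset\mathcal{X}$ is a p.t.a.-metastable set.
   Context: $\mathcal{X}$ is a finite set and $\Delta:\mathcal{X}\times\mathcal{X}\to\mathbb{R}^+\cup\{\infty\}$ (nonnegative values, $0$ allowed) is an irreducible rate function: for all $x,y\in\mathcal{X}$ there is a finite sequence $\omega_1=x,\dots,\omega_n=y$ with $\Delta(\omega_i,\omega_{i+1})<\infty$ for all $i$. For each $\beta>0$, $(X_n)_{n\in\mathbb{N}}$ is a time-homogeneous Markov chain on $\mathcal{X}$ with transition matrix $\mathcal{P}_\beta$, and $\lim_{\beta\to\infty}-\frac{\log\mathcal{P}_\beta(x,y)}{\beta}=\Delta(x,y)$ for all $x,y$. Detailed balance holds: $\mathcal{P}_\beta(x,y)e^{-\beta G(x)}=\mathcal{P}_\beta(y,x)e^{-\beta G(y)}$, where $G:\mathcal{X}\to\mathbb{R}$ is the Hamiltonian (possibly depending on $\beta$). The Gibbs measure is $\mu_\beta(x)=e^{-\beta G(x)}/\sum_{y\in\mathcal{X}}e^{-\beta G(y)}$. The virtual energy is $H(x):=\lim_{\beta\to\infty}G(x)$.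 The transition energy is $H(x,y):=H(x)+\Delta(x,y)$. A path is a finite sequence $\omega=(\omega_1,\dots,\omega_n)$ in $\mathcal{X}$; its height is $\Phi_\omega=H(\omega_1)$ if $|\omega|=1$ and $\Phi_\omega=\max_{i<|\omega|}H(\omega_i,\omega_{i+1})$ if $|\omega|>1$. The communication height is $\Phi(x,y):=\min_{\omega}\Phi_\omega$ over all paths from $x$ to $y$, and $\Phi(A,B):=\min_{x\in A,y\in B}\Phi(x,y)$ for sets. Let $\mathcal{I}_x:=\{y\mid H(y)<H(x)\}$ and $V_x:=\Phi(x,\mathcal{I}_x)-H(x)$, with $V_x=\infty$ if $\mathcal{I}_x=\emptyset$. $\mathcal{X}^s$ is the set of global minima of $H$, $\Gamma_m:=\max_{x\in\mathcal{X}\setminus\mathcal{X}^s}V_x$ and $\mathcal{X}^m:=\{y\in\mathcal{X}\mid V_y=\Gamma_m\}$. The Dirichlet form is $\mathscr{D}_\beta[f]:=\frac12\sum_{y,z\in\mathcal{X}}\mu_\beta(y)\mathcal{P}_\beta(y,z)[f(y)-f(z)]^2$ for $f:\mathcal{X}\to\mathbb{R}$. For nonempty disjoint $Y,Z\subset\mathcal{X}$, the capacity is $\mathrm{cap}_\beta(Y,Z):=\min\{\mathscr{D}_\beta[f]: f:\mathcal{X}\to[0,1],\ f|_Y=1,\ f|_Z=0\}$; singletons are written without braces. A set $M\subset\mathcal{X}$ is p.t.a.-metastable (metastable according to the potential-theoretic approach) if $$\lim_{\beta\to\infty}\frac{\max_{x\notin M}\mu_\beta(x)[\mathrm{cap}_\beta(x,M)]^{-1}}{\min_{x\in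 M}\mu_\beta(x)[\mathrm{cap}_\beta(x,M\setminus\{x\})]^{-1}}=0.$$ *)

theory Defs
  imports Complex_Main "HOL-Library.Extended_Real"
begin

text \<open>
  The state space is a finite type; \<open>P \<beta> x y\<close> are the transition probabilities at inverse
  temperature \<open>\<beta>\<close>, \<open>\<Delta>\<close> is the rate function, \<open>G \<beta>\<close> is the (possibly \<open>\<beta>\<close>-dependent) Hamiltonian
  and \<open>H\<close> is the virtual energy.
\<close>

definition stochastic_matrix :: "('a::finite \<Rightarrow> 'a \<Rightarrow> real) \<Rightarrow> bool" where
  "stochastic_matrix p \<longleftrightarrow> (\<forall>x y. 0 \<le> p x y) \<and> (\<forall>x. (\<Sum>y\<in>UNIV. p x y) = 1)"

text \<open>The value of \<open>- log p / \<beta>\<close> for \<open>\<beta> > 0\<close>, with the convention \<open>- log 0 = \<infinity>\<close>.\<close>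

definition log_rate :: "real \<Rightarrow> real \<Rightarrow> ereal" where
  "log_rate \<beta> p = (if p = 0 then \<infinity> else ereal (- ln p / \<beta>))"

definition paths :: "'a \<Rightarrow> 'a \<Rightarrow> 'a list set" where
  "paths x y = {\<omega>. \<omega> \<noteq> [] \<and> hd \<omega> = x \<and> last \<omega> = y}"

definition irreducible_rate :: "('a \<Rightarrow> 'a \<Rightarrow> ereal) \<Rightarrow> bool" where
  "irreducible_rate \<Delta> \<longleftrightarrow>
     (\<forall>x y. \<exists>\<omega>\<in>paths x y. \<forall>i. Suc i < length \<omega> \<longrightarrow> \<Delta> (\<omega> ! i) (\<omega> ! Suc i) < \<infinity>)"

definition transition_energy :: "('a \<Rightarrow> real) \<Rightarrow> ('a \<Rightarrow> 'a \<Rightarrow> ereal) \<Rightarrow> 'a \<Rightarrow> 'a \<Rightarrow> ereal" where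
  "transition_energy H \<Delta> x y = ereal (H x) + \<Delta> x y"

definition path_height :: "('a \<Rightarrow> real) \<Rightarrow> ('a \<Rightarrow> 'a \<Rightarrow> ereal) \<Rightarrow> 'a list \<Rightarrow> ereal" where
  "path_height H \<Delta> \<omega> =
     (if length \<omega> = 1 then ereal (H (hd \<omega>))
      else Max ((\<lambda>i. transition_energy H \<Delta> (\<omega> ! i) (\<omega> ! Suc i)) ` {i. Suc i < length \<omega>}))"

text \<open>
  Heights of paths take only finitely many values on a finite state space, so the infima below are
  minima (the second one when both sets are nonempty).
\<close>

definition comm_height :: "('a \<Rightarrow> real) \<Rightarrow> ('a \<Rightarrow> 'a \<Rightarrow> ereal) \<Rightarrow> 'a \<Rightarrow> 'a \<Rightarrow> ereal" where
  "comm_height H \<Delta> x y = (INF \<omega>\<in>paths x y. path_height H \<Delta> \<omega>)"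

definition comm_height_sets ::
  "('a \<Rightarrow> real) \<Rightarrow> ('a \<Rightarrow> 'a \<Rightarrow> ereal) \<Rightarrow> 'a set \<Rightarrow> 'a set \<Rightarrow> ereal" where
  "comm_height_sets H \<Delta> A B = (INF x\<in>A. INF y\<in>B. comm_height H \<Delta> x y)"

definition lower_states :: "('a \<Rightarrow> real) \<Rightarrow> 'a \<Rightarrow> 'a set" where
  "lower_states H x = {y. H y < H x}"

definition stability_level :: "('a \<Rightarrow> real) \<Rightarrow> ('a \<Rightarrow> 'a \<Rightarrow> ereal) \<Rightarrow> 'a \<Rightarrow> ereal" where
  "stability_level H \<Delta> x =
     (if lower_states H x = {} then \<infinity>
      else comm_height_sets H \<Delta> {x} (lower_states H x) - ereal (H x))"

definition stable_states :: "('a \<Rightarrow> real) \<Rightarrow> 'a set" where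
  "stable_states H = {x. \<forall>y. H x \<le> H y}"

text \<open>Meaningful only if some state is not stable (otherwise the maximum is over the empty set).\<close>

definition max_stability_level :: "('a::finite \<Rightarrow> real) \<Rightarrow> ('a \<Rightarrow> 'a \<Rightarrow> ereal) \<Rightarrow> ereal" where
  "max_stability_level H \<Delta> = Max (stability_level H \<Delta> ` (UNIV - stable_states H))"

definition metastable_states :: "('a::finite \<Rightarrow> real) \<Rightarrow> ('a \<Rightarrow> 'a \<Rightarrow> ereal) \<Rightarrow> 'a set" where
  "metastable_states H \<Delta> = {y. stability_level H \<Delta> y = max_stability_level H \<Delta>}"

definition gibbs :: "(real \<Rightarrow> 'a::finite \<Rightarrow> real) \<Rightarrow> real \<Rightarrow> 'a \<Rightarrow> real" where
  "gibbs G \<beta> x = exp (- \<beta> * G \<beta> x) / (\<Sum>y\<in>UNIV. exp (- \<beta> * G \<beta> y))"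

definition dirichlet_form ::
  "(real \<Rightarrow> 'a::finite \<Rightarrow> real) \<Rightarrow> (real \<Rightarrow> 'a \<Rightarrow> 'a \<Rightarrow> real) \<Rightarrow> real \<Rightarrow> ('a \<Rightarrow> real) \<Rightarrow> real" where
  "dirichlet_form G P \<beta> f =
     1/2 * (\<Sum>y\<in>UNIV. \<Sum>z\<in>UNIV. gibbs G \<beta> y * P \<beta> y z * (f y - f z)\<^sup>2)"

text \<open>
  For disjoint \<open>Y\<close> and \<open>Z\<close> the infimum is a minimum: a continuous function is minimised over a
  nonempty compact set.
\<close>

definition capacity ::
  "(real \<Rightarrow> 'a::finite \<Rightarrow> real) \<Rightarrow> (real \<Rightarrow> 'a \<Rightarrow> 'a \<Rightarrow> real) \<Rightarrow> real \<Rightarrow> 'a set \<Rightarrow> 'a set \<Rightarrow> real" where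
  "capacity G P \<beta> Y Z =
     (INF f\<in>{f. (\<forall>x. f x \<in> {0..1}) \<and> (\<forall>x\<in>Y. f x = 1) \<and> (\<forall>x\<in>Z. f x = 0)}.
        dirichlet_form G P \<beta> f)"

text \<open>
  Meaningful for proper subsets \<open>M\<close> with at least two elements. For an irreducible rate function
  all capacities involved are then positive for large \<open>\<beta>\<close>, so that the convention
  \<open>inverse 0 = 0\<close> does not affect the limit.
\<close>

definition pta_metastable ::
  "(real \<Rightarrow> 'a::finite \<Rightarrow> real) \<Rightarrow> (real \<Rightarrow> 'a \<Rightarrow> 'a \<Rightarrow> real) \<Rightarrow> 'a set \<Rightarrow> bool" where
  "pta_metastable G P M \<longleftrightarrow>
     ((\<lambda>\<beta>. Max ((\<lambda>x. gibbs G \<beta> x * inverse (capacity G P \<beta> {x} M)) ` (UNIV - M))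
          / Min ((\<lambda>x. gibbs G \<beta> x * inverse (capacity G P \<beta> {x} (M - {x}))) ` M))
      \<longlongrightarrow> 0) at_top"

end

theory Submission
  imports Defs
begin

text \<open>
  On the exponential scale, \<open>\<mu>\<^sub>\<beta>(x) / cap\<^sub>\<beta>(x, A)\<close> grows like \<open>exp (\<beta> (\<Phi>(x, A) - H x))\<close>: along an optimal
  path some edge must carry a fixed fraction of the drop of the test function from 1 to 0, which
  bounds the capacity from below, and the indicator of the part of the state space reachable from
  \<open>x\<close> below level \<open>\<Phi>(x, A)\<close> bounds it from above. Hence a set \<open>M\<close> is p.t.a.-metastable as soon as every
  state outside \<open>M\<close> reaches \<open>M\<close> across a barrier of height less than \<open>v\<close>, while no state of \<open>M\<close>
  reaches another one across such a barrier. With \<open>v = \<Gamma>\<^sub>m\<close> the first condition holds by descending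
  through states of stability level below \<open>\<Gamma>\<^sub>m\<close> (and moving inside the plateau \<open>x\<^sub>1\<^sup>1, \<dots>, x\<^sub>1\<^sup>n\<close>), the
  second because, by reversibility, crossing between two states of \<open>M\<close> is controlled by the
  stability level of the higher one.
\<close>

section \<open>Reachability below an energy level, and communication heights\<close>

definition edge_below :: "('a \<Rightarrow> real) \<Rightarrow> ('a \<Rightarrow> 'a \<Rightarrow> ereal) \<Rightarrow> ereal \<Rightarrow> 'a \<Rightarrow> 'a \<Rightarrow> bool" where
  "edge_below H \<Delta> c x y \<longleftrightarrow> transition_energy H \<Delta> x y < c"

lemma reach_mono:
  assumes "(edge_below H \<Delta> c)\<^sup>*\<^sup>* x y" "c \<le> d"
  shows "(edge_below H \<Delta> d)\<^sup>*\<^sup>* x y"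
  using assms(1)
proof (rule rtranclp_mono[THEN predicate2D, rotated])
  show "edge_below H \<Delta> c \<le> edge_below H \<Delta> d"
    using assms(2) by (auto simp: edge_below_def)
qed

text \<open>A walk uses finitely many edges, so its strict inequalities leave room for a real level
  below \<open>c\<close>. This slack later separates exponential rates. The condition
  \<open>c \<noteq> -\<infinity>\<close> serves the empty walk.\<close>

lemma reach_strictly_below:
  assumes "(edge_below H \<Delta> c)\<^sup>*\<^sup>* x y" "c \<noteq> -\<infinity>"
  shows "\<exists>d. ereal d < c \<and> (edge_below H \<Delta> (ereal d))\<^sup>*\<^sup>* x y"
  using assms(1)
proof (induction rule: rtranclp_induct)
  case base
  have "-\<infinity> < c" using assms(2) by simp
  then show ?case using ereal_dense2 by blast
next
  case (step y z)
  then obtain d where d: "ereal d < c" "(edge_below H \<Delta> (ereal d))\<^sup>*\<^sup>* x y" by blast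
  from step(2) obtain e where e: "transition_energy H \<Delta> y z < ereal e" "ereal e < c"
    unfolding edge_below_def using ereal_dense2 by blast
  have "(edge_below H \<Delta> (ereal (max d e)))\<^sup>*\<^sup>* x y"
    using d(2) by (rule reach_mono) simp
  moreover have "edge_below H \<Delta> (ereal (max d e)) y z"
    using e(1) by (simp add: edge_below_def less_le_trans)
  ultimately have "(edge_below H \<Delta> (ereal (max d e)))\<^sup>*\<^sup>* x z" by simp
  moreover have "ereal (max d e) < c" using d(1) e(2) by (simp add: max_def)
  ultimately show ?case by blast
qed

lemma path_edges_reach:
  assumes "\<omega> \<noteq> []" "\<And>i. Suc i < length \<omega> \<Longrightarrow> R (\<omega> ! i) (\<omega> ! Suc i)"
  shows "R\<^sup>*\<^sup>* (hd \<omega>) (last \<omega>)"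
  using assms
proof (induction \<omega> rule: list_nonempty_induct)
  case (single x)
  then show ?case by simp
next
  case (cons x xs)
  have "R (xs ! i) (xs ! Suc i)" if "Suc i < length xs" for i
    using cons.prems[of "Suc i"] that by simp
  then have "R\<^sup>*\<^sup>* (hd xs) (last xs)" by (rule cons.IH)
  moreover have "R x (hd xs)"
    using cons.prems[of 0] cons.hyps by (simp add: hd_conv_nth)
  ultimately show ?case using cons.hyps by (simp add: converse_rtranclp_into_rtranclp)
qed

lemma path_height_less_iff:
  assumes "length \<omega> \<ge> 2"
  shows "path_height H \<Delta> \<omega> < c \<longleftrightarrow>
    (\<forall>i. Suc i < length \<omega> \<longrightarrow> edge_below H \<Delta> c (\<omega> ! i) (\<omega> ! Suc i))"
proof -
  have "finite {i. Suc i < length \<omega>}" by (rule finite_subset[of _ "{..<length \<omega>}"]) auto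
  moreover have "0 \<in> {i. Suc i < length \<omega>}" using assms by auto
  ultimately have "Max ((\<lambda>i. transition_energy H \<Delta> (\<omega> ! i) (\<omega> ! Suc i)) ` {i. Suc i < length \<omega>}) < c
      \<longleftrightarrow> (\<forall>i. Suc i < length \<omega> \<longrightarrow> transition_energy H \<Delta> (\<omega> ! i) (\<omega> ! Suc i) < c)"
    by (subst Max_less_iff) auto
  then show ?thesis using assms by (simp add: path_height_def edge_below_def)
qed

lemma comm_height_less_imp_reach:
  assumes "comm_height H \<Delta> x y < c"
  shows "(edge_below H \<Delta> c)\<^sup>*\<^sup>* x y"
proof -
  obtain \<omega> where \<omega>: "\<omega> \<in> paths x y" "path_height H \<Delta> \<omega> < c"
    using assms unfolding comm_height_def INF_less_iff by blast
  have ne: "\<omega> \<noteq> []" and hl: "hd \<omega> = x" "last \<omega> = y" using \<omega>(1) by (auto simp: paths_def)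
  have "edge_below H \<Delta> c (\<omega> ! i) (\<omega> ! Suc i)" if "Suc i < length \<omega>" for i
    using that \<omega>(2) path_height_less_iff[of \<omega> H \<Delta> c] by auto
  then show ?thesis using path_edges_reach[of \<omega> "edge_below H \<Delta> c"] ne hl by simp
qed

text \<open>Distinct endpoints force a walk with at least one edge. At \<open>x = y\<close>
  reachability is trivial, whereas the one-state path has height \<open>H x\<close>, which need not
  lie below \<open>c\<close>.\<close>

lemma reach_imp_comm_height_less:
  assumes "(edge_below H \<Delta> c)\<^sup>*\<^sup>* x y" "x \<noteq> y"
  shows "comm_height H \<Delta> x y < c"
proof -
  have "(edge_below H \<Delta> c)\<^sup>+\<^sup>+ x y" using rtranclpD[OF assms(1)] assms(2) by simp
  \<comment> \<open>The length bound strengthens the induction, since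
    \<open>path_height_less_iff\<close> covers only paths with an edge.\<close>
  then have "\<exists>\<omega>\<in>paths x y. length \<omega> \<ge> 2 \<and> path_height H \<Delta> \<omega> < c"
  proof (induction rule: converse_tranclp_induct)
    case (base x)
    have "path_height H \<Delta> [x, y] < c"
      using base by (subst path_height_less_iff) auto
    then show ?case by (intro bexI[of _ "[x, y]"]) (auto simp: paths_def)
  next
    case (step x z)
    then obtain \<omega> where \<omega>: "\<omega> \<in> paths z y" "length \<omega> \<ge> 2" "path_height H \<Delta> \<omega> < c" by blast
    have hd: "\<omega> \<noteq> []" "\<omega> ! 0 = z" using \<omega>(1) by (auto simp: paths_def hd_conv_nth)
    have "path_height H \<Delta> (x # \<omega>) < c"
    proof (subst path_height_less_iff)
      show "\<forall>i. Suc i < length (x # \<omega>) \<longrightarrow> edge_below H \<Delta> c ((x # \<omega>) ! i) ((x # \<omega>) ! Suc i)"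
      proof (intro allI impI)
        fix i assume "Suc i < length (x # \<omega>)"
        then show "edge_below H \<Delta> c ((x # \<omega>) ! i) ((x # \<omega>) ! Suc i)"
          using \<omega>(2,3) step(1) hd path_height_less_iff[of \<omega> H \<Delta> c] by (cases i) auto
      qed
    qed (use \<omega>(2) in auto)
    then show ?case using \<omega>(1,2) by (intro bexI[of _ "x # \<omega>"]) (auto simp: paths_def)
  qed
  then show ?thesis unfolding comm_height_def INF_less_iff by blast
qed

lemma irreducible_rate_reach:
  assumes "irreducible_rate \<Delta>"
  shows "(edge_below H \<Delta> \<infinity>)\<^sup>*\<^sup>* x y"
proof -
  obtain \<omega> where \<omega>: "\<omega> \<in> paths x y" "\<forall>i. Suc i < length \<omega> \<longrightarrow> \<Delta> (\<omega> ! i) (\<omega> ! Suc i) < \<infinity>"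
    using assms unfolding irreducible_rate_def by blast
  have "\<omega> \<noteq> []" "hd \<omega> = x" "last \<omega> = y" using \<omega>(1) by (auto simp: paths_def)
  then show ?thesis
    using path_edges_reach[of \<omega> "edge_below H \<Delta> \<infinity>"] \<omega>(2)
    by (auto simp: edge_below_def transition_energy_def)
qed

text \<open>A strictly lower \<open>y\<close> differs from \<open>x\<close>, so both translations
  between heights and reachability apply. Nonemptiness excludes the case where the level is
  \<open>\<infinity>\<close> by convention.\<close>

lemma stability_level_less_iff:
  assumes "lower_states H x \<noteq> {}"
  shows "stability_level H \<Delta> x < ereal v \<longleftrightarrow>
    (\<exists>y. H y < H x \<and> (edge_below H \<Delta> (ereal (v + H x)))\<^sup>*\<^sup>* x y)"
proof -
  have "stability_level H \<Delta> x < ereal v \<longleftrightarrow>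
      comm_height_sets H \<Delta> {x} (lower_states H x) < ereal (v + H x)"
    using assms by (cases "comm_height_sets H \<Delta> {x} (lower_states H x)")
      (auto simp: stability_level_def)
  also have "\<dots> \<longleftrightarrow> (\<exists>y. H y < H x \<and> comm_height H \<Delta> x y < ereal (v + H x))"
    by (auto simp: comm_height_sets_def INF_less_iff lower_states_def)
  also have "\<dots> \<longleftrightarrow> (\<exists>y. H y < H x \<and> (edge_below H \<Delta> (ereal (v + H x)))\<^sup>*\<^sup>* x y)"
    using comm_height_less_imp_reach reach_imp_comm_height_less by (metis less_irrefl)
  finally show ?thesis .
qed

text \<open>\<open>K\<close> counts the steps of one fixed walk, plus one. It is chosen before
  \<open>f\<close> and \<open>B\<close>, hence is uniform over all test functions and, later, over
  \<open>\<beta>\<close>.\<close>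

lemma reach_Lipschitz:
  assumes "R\<^sup>*\<^sup>* x y"
  shows "\<exists>K>0. \<forall>f B. (\<forall>a b. R a b \<longrightarrow> \<bar>f a - f b\<bar> \<le> B) \<longrightarrow> B \<ge> 0 \<longrightarrow> \<bar>f x - f y\<bar> \<le> K * (B::real)"
  using assms
proof (induction rule: rtranclp_induct)
  case base
  show ?case by (intro exI[of _ 1]) auto
next
  case (step y z)
  then obtain K where K: "K > 0"
    "\<And>f B. (\<forall>a b. R a b \<longrightarrow> \<bar>f a - f b\<bar> \<le> B) \<Longrightarrow> B \<ge> 0 \<Longrightarrow> \<bar>f x - f y\<bar> \<le> K * (B::real)"
    by blast
  show ?case
  proof (intro exI[of _ "K + 1"] conjI allI impI)
    fix f :: "'a \<Rightarrow> real" and B :: real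
    assume B: "\<forall>a b. R a b \<longrightarrow> \<bar>f a - f b\<bar> \<le> B" "B \<ge> 0"
    have "\<bar>f x - f y\<bar> \<le> K * B" using K(2) B by blast
    moreover have "\<bar>f y - f z\<bar> \<le> B" using B(1) step(2) by blast
    ultimately show "\<bar>f x - f z\<bar> \<le> (K + 1) * B" by (simp add: algebra_simps)
  qed (use K(1) in simp)
qed

section \<open>Edge weights of the chain and their exponential rates\<close>

locale low_temperature_chain =
  fixes P :: "real \<Rightarrow> 'a::finite \<Rightarrow> 'a \<Rightarrow> real"
    and \<Delta> :: "'a \<Rightarrow> 'a \<Rightarrow> ereal"
    and G :: "real \<Rightarrow> 'a \<Rightarrow> real"
    and H :: "'a \<Rightarrow> real"
  assumes rate_nonneg: "\<And>x y. 0 \<le> \<Delta> x y"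
    and irreducible: "irreducible_rate \<Delta>"
    and stochastic: "\<And>\<beta>. \<beta> > 0 \<Longrightarrow> stochastic_matrix (P \<beta>)"
    and rate_limit: "\<And>x y. ((\<lambda>\<beta>. log_rate \<beta> (P \<beta> x y)) \<longlongrightarrow> \<Delta> x y) at_top"
    and detailed_balance:
      "\<And>\<beta> x y. \<beta> > 0 \<Longrightarrow> P \<beta> x y * exp (- \<beta> * G \<beta> x) = P \<beta> y x * exp (- \<beta> * G \<beta> y)"
    and energy_limit: "\<And>x. ((\<lambda>\<beta>. G \<beta> x) \<longlongrightarrow> H x) at_top"
begin

abbreviation reach :: "real \<Rightarrow> 'a \<Rightarrow> 'a \<Rightarrow> bool" where
  "reach c \<equiv> (edge_below H \<Delta> (ereal c))\<^sup>*\<^sup>*"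

abbreviation energy :: "'a \<Rightarrow> 'a \<Rightarrow> ereal" where
  "energy \<equiv> transition_energy H \<Delta>"

text \<open>The conductance \<open>\<mu>(x) P(x,y)\<close> times the partition function. Without the
  normalisation its exponential rate is \<open>energy x y\<close> itself.\<close>

definition weight :: "real \<Rightarrow> 'a \<Rightarrow> 'a \<Rightarrow> real" where
  "weight \<beta> x y = exp (- \<beta> * G \<beta> x) * P \<beta> x y"

definition partition_sum :: "real \<Rightarrow> real" where
  "partition_sum \<beta> = (\<Sum>y\<in>UNIV. exp (- \<beta> * G \<beta> y))"

lemma partition_sum_pos: "partition_sum \<beta> > 0"
  unfolding partition_sum_def by (intro sum_pos) auto

lemma gibbs_eq: "gibbs G \<beta> x = exp (- \<beta> * G \<beta> x) / partition_sum \<beta>"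
  by (simp add: gibbs_def partition_sum_def)

lemma prob_nonneg: "\<beta> > 0 \<Longrightarrow> P \<beta> x y \<ge> 0"
  using stochastic by (auto simp: stochastic_matrix_def)

lemma weight_nonneg: "\<beta> > 0 \<Longrightarrow> weight \<beta> x y \<ge> 0"
  by (simp add: weight_def prob_nonneg)

lemma weight_sym: "\<beta> > 0 \<Longrightarrow> weight \<beta> x y = weight \<beta> y x"
  using detailed_balance[of \<beta> x y] by (simp add: weight_def mult.commute)

lemma dirichlet_form_eq:
  "dirichlet_form G P \<beta> f =
    (\<Sum>y\<in>UNIV. \<Sum>z\<in>UNIV. weight \<beta> y z * (f y - f z)\<^sup>2) / (2 * partition_sum \<beta>)"
  by (simp add: dirichlet_form_def gibbs_eq weight_def sum_divide_distrib sum_distrib_left field_simps)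

text \<open>Written as a sum so that the limit can be taken termwise; for \<open>\<beta> > 0\<close>
  it is the exponential rate of \<open>weight\<close>.\<close>

definition log_weight :: "real \<Rightarrow> 'a \<Rightarrow> 'a \<Rightarrow> ereal" where
  "log_weight \<beta> x y = ereal (G \<beta> x) + log_rate \<beta> (P \<beta> x y)"

lemma log_weight_eq:
  assumes "\<beta> > 0"
  shows "log_weight \<beta> x y = log_rate \<beta> (weight \<beta> x y)"
proof (cases "P \<beta> x y = 0")
  case True
  then show ?thesis by (simp add: log_weight_def log_rate_def weight_def)
next
  case False
  then have "P \<beta> x y > 0" using prob_nonneg[OF assms, of x y] by simp
  then show ?thesis using assms
    by (simp add: log_weight_def log_rate_def weight_def ln_mult field_simps)
qed

lemma log_weight_limit: "((\<lambda>\<beta>. log_weight \<beta> x y) \<longlongrightarrow> energy x y) at_top"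
  unfolding log_weight_def transition_energy_def
  \<comment> \<open>Nonnegativity keeps \<open>\<Delta> x y\<close> away from
    \<open>-\<infinity>\<close>, where addition of extended reals may fail to be continuous.\<close>
  using rate_nonneg[of x y]
  by (intro tendsto_add_ereal_nonneg rate_limit) (auto simp: energy_limit)

text \<open>Detailed balance makes the weights symmetric at every positive \<open>\<beta>\<close>,
  and limits are unique. Reversibility enters the energy landscape here.\<close>

lemma energy_sym: "energy x y = energy y x"
proof (rule tendsto_unique)
  show "((\<lambda>\<beta>. log_weight \<beta> x y) \<longlongrightarrow> energy x y) at_top" by (rule log_weight_limit)
  have "eventually (\<lambda>\<beta>. log_weight \<beta> y x = log_weight \<beta> x y) at_top"
    using eventually_gt_at_top[of 0]
    by eventually_elim (simp add: log_weight_eq weight_sym)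
  then show "((\<lambda>\<beta>. log_weight \<beta> x y) \<longlongrightarrow> energy y x) at_top"
    using log_weight_limit[of y x] by (simp add: tendsto_cong)
qed simp

lemma reach_sym: "reach c x y \<Longrightarrow> reach c y x"
  using symp_rtranclp[of "edge_below H \<Delta> (ereal c)"] energy_sym
  by (metis edge_below_def sympD sympI)

lemma weight_ge:
  assumes "energy x y < ereal c"
  shows "eventually (\<lambda>\<beta>. weight \<beta> x y \<ge> exp (- \<beta> * c)) at_top"
  using order_tendstoD(2)[OF log_weight_limit assms] eventually_gt_at_top[of 0]
proof eventually_elim
  case (elim \<beta>)
  \<comment> \<open>A rate below the real number \<open>c\<close> is finite, which rules out a
    vanishing weight.\<close>
  then have nz: "weight \<beta> x y \<noteq> 0" and "- ln (weight \<beta> x y) / \<beta> < c"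
    by (auto simp: log_weight_eq log_rate_def split: if_splits)
  then have "- \<beta> * c \<le> ln (weight \<beta> x y)" using elim(2) by (simp add: field_simps)
  moreover have "weight \<beta> x y > 0" using nz weight_nonneg[OF elim(2), of x y] by simp
  ultimately show ?case by (metis exp_le_cancel_iff exp_ln)
qed

lemma weight_le:
  assumes "ereal c < energy x y"
  shows "eventually (\<lambda>\<beta>. weight \<beta> x y \<le> exp (- \<beta> * c)) at_top"
  using order_tendstoD(1)[OF log_weight_limit assms] eventually_gt_at_top[of 0]
proof eventually_elim
  case (elim \<beta>)
  show ?case
  proof (cases "weight \<beta> x y = 0")
    case False
    then have "c < - ln (weight \<beta> x y) / \<beta>"
      using elim by (auto simp: log_weight_eq log_rate_def)
    then have "ln (weight \<beta> x y) \<le> - \<beta> * c" using elim(2) by (simp add: field_simps)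
    moreover have "weight \<beta> x y > 0" using False weight_nonneg[OF elim(2), of x y] by simp
    ultimately show ?thesis by (metis exp_le_cancel_iff exp_ln)
  qed simp
qed

section \<open>Two-sided exponential bounds on capacities\<close>

lemma dirichlet_form_nonneg: "\<beta> > 0 \<Longrightarrow> dirichlet_form G P \<beta> f \<ge> 0"
  unfolding dirichlet_form_eq using partition_sum_pos[of \<beta>]
  by (auto intro!: divide_nonneg_pos sum_nonneg mult_nonneg_nonneg weight_nonneg)

lemma dirichlet_form_edge:
  assumes "\<beta> > 0"
  shows "weight \<beta> a b * (f a - f b)\<^sup>2 \<le> 2 * partition_sum \<beta> * dirichlet_form G P \<beta> f"
proof -
  have nn: "0 \<le> weight \<beta> y z * (f y - f z)\<^sup>2" for y z using weight_nonneg[OF assms] by simp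
  have "weight \<beta> a b * (f a - f b)\<^sup>2 \<le> (\<Sum>z\<in>UNIV. weight \<beta> a z * (f a - f z)\<^sup>2)"
    by (rule member_le_sum) (auto simp: nn)
  also have "\<dots> \<le> (\<Sum>y\<in>UNIV. \<Sum>z\<in>UNIV. weight \<beta> y z * (f y - f z)\<^sup>2)"
    by (rule member_le_sum[of a UNIV "\<lambda>y. \<Sum>z\<in>UNIV. weight \<beta> y z * (f y - f z)\<^sup>2"])
      (auto intro!: sum_nonneg nn)
  finally show ?thesis using partition_sum_pos[of \<beta>] by (simp add: dirichlet_form_eq)
qed

lemma test_functions_nonempty:
  assumes "x \<notin> M"
  shows "{f :: 'a \<Rightarrow> real. (\<forall>x. f x \<in> {0..1}) \<and> (\<forall>x\<in>{x}. f x = 1) \<and> (\<forall>x\<in>M. f x = 0)} \<noteq> {}"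
proof -
  have "(\<lambda>y. if y = x then 1 else 0) \<in>
      {f :: 'a \<Rightarrow> real. (\<forall>x. f x \<in> {0..1}) \<and> (\<forall>x\<in>{x}. f x = 1) \<and> (\<forall>x\<in>M. f x = 0)}"
    using assms by auto
  then show ?thesis by (rule ex_in_conv[THEN iffD1, OF exI])
qed

text \<open>A test function falls from 1 at \<open>x\<close> to 0 at \<open>m\<close> along a walk
  whose edges all have weight at least \<open>exp (- \<beta> * c)\<close>. Some edge carries a fixed
  share of the fall and makes the Dirichlet form large.\<close>

lemma capacity_ge:
  assumes "reach c x m" "m \<in> M" "x \<notin> M"
  shows "\<exists>K>0. eventually (\<lambda>\<beta>. capacity G P \<beta> {x} M \<ge> K * exp (- \<beta> * c) / partition_sum \<beta>) at_top"
proof -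
  obtain K where K: "K > 0" "\<And>f B. (\<forall>a b. edge_below H \<Delta> (ereal c) a b \<longrightarrow> \<bar>f a - f b\<bar> \<le> B) \<Longrightarrow>
      B \<ge> 0 \<Longrightarrow> \<bar>f x - f m\<bar> \<le> K * (B::real)"
    using reach_Lipschitz[OF assms(1)] by blast
  \<comment> \<open>Finiteness of the state space gives one threshold in \<open>\<beta>\<close> for
    all edges, independent of the test function.\<close>
  have "eventually (\<lambda>\<beta>. \<forall>a b. edge_below H \<Delta> (ereal c) a b \<longrightarrow> weight \<beta> a b \<ge> exp (- \<beta> * c)) at_top"
  proof (intro eventually_all_finite)
    fix a b
    show "eventually (\<lambda>\<beta>. edge_below H \<Delta> (ereal c) a b \<longrightarrow> weight \<beta> a b \<ge> exp (- \<beta> * c)) at_top"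
      using weight_ge[of a b c] by (cases "edge_below H \<Delta> (ereal c) a b") (auto simp: edge_below_def)
  qed
  then have "eventually (\<lambda>\<beta>. capacity G P \<beta> {x} M \<ge>
      (1 / (2 * K\<^sup>2)) * exp (- \<beta> * c) / partition_sum \<beta>) at_top"
    using eventually_gt_at_top[of 0]
  proof eventually_elim
    case (elim \<beta>)
    let ?Z = "partition_sum \<beta>"
    have Z: "?Z > 0" by (rule partition_sum_pos)
    show ?case unfolding capacity_def
    proof (rule cINF_greatest)
      show "{f. (\<forall>x. f x \<in> {0..(1::real)}) \<and> (\<forall>x\<in>{x}. f x = 1) \<and> (\<forall>x\<in>M. f x = 0)} \<noteq> {}"
        using assms(3) by (rule test_functions_nonempty)
    next
      fix f assume "f \<in> {f. (\<forall>x. f x \<in> {0..(1::real)}) \<and> (\<forall>x\<in>{x}. f x = 1) \<and> (\<forall>x\<in>M. f x = 0)}"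
      then have f: "f x = 1" "f m = 0" using assms(2) by auto
      define D where "D = dirichlet_form G P \<beta> f"
      \<comment> \<open>The largest increment over an edge below \<open>c\<close> that is compatible
        with Dirichlet form \<open>D\<close>.\<close>
      define B where "B = sqrt (2 * ?Z * D * exp (\<beta> * c))"
      have D: "D \<ge> 0" using elim(2) by (simp add: D_def dirichlet_form_nonneg)
      have "\<bar>f a - f b\<bar> \<le> B" if "edge_below H \<Delta> (ereal c) a b" for a b
      proof -
        have "exp (- \<beta> * c) * (f a - f b)\<^sup>2 \<le> weight \<beta> a b * (f a - f b)\<^sup>2"
          using elim(1) that by (intro mult_right_mono) auto
        also have "\<dots> \<le> 2 * ?Z * D" unfolding D_def by (rule dirichlet_form_edge[OF elim(2)])
        finally have "exp (\<beta> * c) * (exp (- \<beta> * c) * (f a - f b)\<^sup>2) \<le> exp (\<beta> * c) * (2 * ?Z * D)"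
          by (rule mult_left_mono) simp
        then have "(f a - f b)\<^sup>2 \<le> 2 * ?Z * D * exp (\<beta> * c)"
          by (simp add: exp_minus field_simps)
        then show ?thesis unfolding B_def by (intro real_le_rsqrt) simp
      qed
      moreover have B0: "B \<ge> 0" using D Z by (simp add: B_def)
      \<comment> \<open>The total fall is 1. Squaring and solving for \<open>D\<close> produces the
        constant \<open>1 / (2 * K\<^sup>2)\<close>.\<close>
      ultimately have "1 \<le> K * B" using K(2)[of f B] f by auto
      then have "1\<^sup>2 \<le> (K * B)\<^sup>2" by (intro power_mono) auto
      also have "\<dots> = K\<^sup>2 * (2 * ?Z * D * exp (\<beta> * c))"
        using D Z by (simp add: B_def power_mult_distrib)
      finally show "1 / (2 * K\<^sup>2) * exp (- \<beta> * c) / ?Z \<le> dirichlet_form G P \<beta> f"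
        using K(1) Z by (simp add: D_def exp_minus field_simps)
    qed
  qed
  moreover have "1 / (2 * K\<^sup>2) > 0" using K(1) by simp
  ultimately show ?thesis by blast
qed

text \<open>The trial function is the indicator of the component of \<open>x\<close> below level
  \<open>c\<close>. Only edges leaving the component contribute, and their energies exceed
  \<open>d\<close>. The gap \<open>d < c\<close> gives the strict inequality that
  \<open>weight_le\<close> requires.\<close>

lemma capacity_le:
  assumes unreachable: "\<And>m. m \<in> M \<Longrightarrow> \<not> reach c x m" and "d < c"
  shows "eventually (\<lambda>\<beta>. capacity G P \<beta> {x} M \<le>
    (real (card (UNIV :: 'a set)))\<^sup>2 * exp (- \<beta> * d) / partition_sum \<beta>) at_top"
proof -
  define f :: "'a \<Rightarrow> real" where "f y = (if reach c x y then 1 else 0)" for y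
  have "ereal d < energy y z" if "f y \<noteq> f z" for y z
  proof (rule ccontr)
    assume "\<not> ereal d < energy y z"
    \<comment> \<open>By symmetry such an edge can be crossed both ways below \<open>c\<close>, so
      its ends lie in the same component.\<close>
    then have "energy y z \<le> ereal d" "energy z y \<le> ereal d" by (auto simp: energy_sym[of z y])
    moreover have "ereal d < ereal c" using \<open>d < c\<close> by simp
    ultimately have "edge_below H \<Delta> (ereal c) y z" "edge_below H \<Delta> (ereal c) z y"
      unfolding edge_below_def using le_less_trans by blast+
    then have "reach c x y \<longleftrightarrow> reach c x z" by (meson rtranclp.rtrancl_into_rtrancl)
    with that show False by (simp add: f_def)
  qed
  then have "eventually (\<lambda>\<beta>. \<forall>y z. f y \<noteq> f z \<longrightarrow> weight \<beta> y z \<le> exp (- \<beta> * d)) at_top"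
  proof (intro eventually_all_finite)
    fix y z
    assume high: "\<And>y z. f y \<noteq> f z \<Longrightarrow> ereal d < energy y z"
    show "eventually (\<lambda>\<beta>. f y \<noteq> f z \<longrightarrow> weight \<beta> y z \<le> exp (- \<beta> * d)) at_top"
      using weight_le[OF high, of y z] by (cases "f y = f z") auto
  qed
  then show ?thesis using eventually_gt_at_top[of 0]
  proof eventually_elim
    case (elim \<beta>)
    let ?Z = "partition_sum \<beta>"
    have Z: "?Z > 0" by (rule partition_sum_pos)
    have "capacity G P \<beta> {x} M \<le> dirichlet_form G P \<beta> f" unfolding capacity_def
    proof (rule cINF_lower)
      show "bdd_below (dirichlet_form G P \<beta> `
          {f. (\<forall>x. f x \<in> {0..1}) \<and> (\<forall>x\<in>{x}. f x = 1) \<and> (\<forall>x\<in>M. f x = 0)})"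
        using dirichlet_form_nonneg[OF elim(2)] by (intro bdd_belowI[of _ 0]) auto
    qed (use unreachable in \<open>auto simp: f_def\<close>)
    also have "\<dots> \<le> (\<Sum>y::'a\<in>UNIV. \<Sum>z::'a\<in>UNIV. exp (- \<beta> * d)) / (2 * ?Z)"
      unfolding dirichlet_form_eq
    proof (intro divide_right_mono sum_mono)
      fix y z
      show "weight \<beta> y z * (f y - f z)\<^sup>2 \<le> exp (- \<beta> * d)"
      proof (cases "f y = f z")
        case False
        then have "(f y - f z)\<^sup>2 = 1" by (auto simp: f_def split: if_splits)
        then show ?thesis using elim(1) False by simp
      qed simp
    qed (use Z in simp)
    also have "\<dots> = (real (card (UNIV :: 'a set)))\<^sup>2 * exp (- \<beta> * d) / (2 * ?Z)"
      by (simp add: power2_eq_square)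
    also have "\<dots> \<le> (real (card (UNIV :: 'a set)))\<^sup>2 * exp (- \<beta> * d) / ?Z"
      using Z by (intro divide_left_mono) auto
    finally show ?case .
  qed
qed

section \<open>Exponential growth of the Gibbs weight divided by the capacity\<close>

lemma gibbs_capacity_ratio_le:
  assumes "reach (v + H x) x m" "m \<in> M" "x \<notin> M"
  shows "\<exists>u<v. \<exists>C>0. eventually (\<lambda>\<beta>.
    gibbs G \<beta> x * inverse (capacity G P \<beta> {x} M) \<le> C * exp (\<beta> * u)) at_top"
proof -
  \<comment> \<open>The slack between \<open>c\<close> and \<open>v + H x\<close> leaves room for a
    rate \<open>u < v\<close> that also absorbs the error of \<open>G \<beta> x\<close> against
    \<open>H x\<close>. The partition sum cancels in the ratio.\<close>
  obtain c where c: "c < v + H x" "reach c x m" using reach_strictly_below[OF assms(1)] by auto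
  obtain K where K: "K > 0" "eventually (\<lambda>\<beta>. capacity G P \<beta> {x} M \<ge>
      K * exp (- \<beta> * c) / partition_sum \<beta>) at_top"
    using capacity_ge[OF c(2) assms(2,3)] by blast
  obtain u where u: "c - H x < u" "u < v" using dense[of "c - H x" v] c(1) by auto
  have "eventually (\<lambda>\<beta>. G \<beta> x > c - u) at_top"
    using u(1) by (intro order_tendstoD[OF energy_limit]) auto
  with K(2) have "eventually (\<lambda>\<beta>. gibbs G \<beta> x * inverse (capacity G P \<beta> {x} M) \<le>
      inverse K * exp (\<beta> * u)) at_top"
    using eventually_gt_at_top[of 0]
  proof eventually_elim
    case (elim \<beta>)
    let ?Z = "partition_sum \<beta>"
    have Z: "?Z > 0" by (rule partition_sum_pos)
    have "gibbs G \<beta> x * inverse (capacity G P \<beta> {x} M) \<le>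
        gibbs G \<beta> x * inverse (K * exp (- \<beta> * c) / ?Z)"
      using elim(1) K(1) Z by (intro mult_left_mono le_imp_inverse_le) (auto simp: gibbs_eq)
    also have "\<dots> = inverse K * exp (\<beta> * (c - G \<beta> x))"
      using Z K(1) by (simp add: gibbs_eq exp_minus exp_diff algebra_simps divide_simps)
    also have "\<dots> \<le> inverse K * exp (\<beta> * u)"
      using elim(2,3) K(1) by (intro mult_left_mono) auto
    finally show ?case .
  qed
  moreover have "inverse K > 0" using K(1) by simp
  ultimately show ?thesis using u(2) by blast
qed

lemma gibbs_capacity_ratio_ge:
  assumes "\<And>m. m \<in> M \<Longrightarrow> \<not> reach (v + H x) x m" "x \<notin> M" "M \<noteq> {}" "u < v"
  shows "\<exists>C>0. eventually (\<lambda>\<beta>.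
    gibbs G \<beta> x * inverse (capacity G P \<beta> {x} M) \<ge> C * exp (\<beta> * u)) at_top"
proof -
  obtain m where m: "m \<in> M" using assms(3) by blast
  \<comment> \<open>Any finite level \<open>b\<close> will do: it only makes the capacity positive,
    so that \<open>inverse\<close> is a genuine reciprocal and reverses the inequality.\<close>
  obtain b where b: "reach b x m"
    using reach_strictly_below[OF irreducible_rate_reach[OF irreducible, of H x m]] by auto
  obtain K where K: "K > 0" "eventually (\<lambda>\<beta>. capacity G P \<beta> {x} M \<ge>
      K * exp (- \<beta> * b) / partition_sum \<beta>) at_top"
    using capacity_ge[OF b m assms(2)] by blast
  obtain d where d: "u + H x < d" "d < v + H x" using dense[of "u + H x" "v + H x"] assms(4) by auto
  define N where "N = (real (card (UNIV :: 'a set)))\<^sup>2"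
  have N: "N > 0" by (simp add: N_def)
  have "eventually (\<lambda>\<beta>. G \<beta> x < d - u) at_top"
    using d(1) by (intro order_tendstoD[OF energy_limit]) auto
  moreover have "eventually (\<lambda>\<beta>. capacity G P \<beta> {x} M \<le> N * exp (- \<beta> * d) / partition_sum \<beta>) at_top"
    unfolding N_def using assms(1) d(2) by (rule capacity_le)
  ultimately have "eventually (\<lambda>\<beta>. gibbs G \<beta> x * inverse (capacity G P \<beta> {x} M) \<ge>
      inverse N * exp (\<beta> * u)) at_top"
    using K(2) eventually_gt_at_top[of 0]
  proof eventually_elim
    case (elim \<beta>)
    let ?Z = "partition_sum \<beta>"
    have Z: "?Z > 0" by (rule partition_sum_pos)
    have "0 < K * exp (- \<beta> * b) / ?Z" using Z K(1) by simp
    with elim(3) have pos: "capacity G P \<beta> {x} M > 0" by linarith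
    have "inverse N * exp (\<beta> * u) \<le> inverse N * exp (\<beta> * (d - G \<beta> x))"
      using elim(1,4) N by (intro mult_left_mono) auto
    also have "\<dots> = gibbs G \<beta> x * inverse (N * exp (- \<beta> * d) / ?Z)"
      using Z N by (simp add: gibbs_eq exp_minus exp_diff algebra_simps divide_simps)
    also have "\<dots> \<le> gibbs G \<beta> x * inverse (capacity G P \<beta> {x} M)"
      using elim(2) pos Z by (intro mult_left_mono le_imp_inverse_le) (auto simp: gibbs_eq)
    finally show ?case .
  qed
  moreover have "inverse N > 0" using N by simp
  ultimately show ?thesis by blast
qed

lemma capacity_nonneg:
  assumes "\<beta> > 0" "x \<notin> M"
  shows "capacity G P \<beta> {x} M \<ge> 0"
  unfolding capacity_def
  by (intro cINF_greatest test_functions_nonempty assms(2) dirichlet_form_nonneg assms(1))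

text \<open>Each numerator grows at a rate strictly below \<open>v\<close>, each denominator at
  least at any prescribed rate below \<open>v\<close>. \<open>proper\<close> and \<open>two\<close>
  make the maximum and all target sets \<open>M - {x}\<close> nonempty.\<close>

lemma pta_metastable_if_barriers:
  assumes escape: "\<And>x. x \<notin> M \<Longrightarrow> \<exists>m\<in>M. reach (v + H x) x m"
    and trapped: "\<And>x m. x \<in> M \<Longrightarrow> m \<in> M \<Longrightarrow> m \<noteq> x \<Longrightarrow> \<not> reach (v + H x) x m"
    and proper: "M \<noteq> UNIV" and two: "\<And>x. M \<noteq> {x}"
  shows "pta_metastable G P M"
proof -
  define a where "a \<beta> x = gibbs G \<beta> x * inverse (capacity G P \<beta> {x} M)" for \<beta> x
  define b where "b \<beta> x = gibbs G \<beta> x * inverse (capacity G P \<beta> {x} (M - {x}))" for \<beta> x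
  have ne: "M \<noteq> {}" "UNIV - M \<noteq> {}" using escape proper by blast+
  have gibbs_nonneg: "gibbs G \<beta> x \<ge> 0" for \<beta> x
    using partition_sum_pos[of \<beta>] by (simp add: gibbs_eq)
  have a0: "a \<beta> x \<ge> 0" if "\<beta> > 0" "x \<notin> M" for \<beta> x
    using capacity_nonneg[OF that] gibbs_nonneg by (simp add: a_def)
  have b0: "b \<beta> m \<ge> 0" if "\<beta> > 0" for \<beta> m
    using capacity_nonneg[OF that, of m "M - {m}"] gibbs_nonneg by (simp add: b_def)
  have "((\<lambda>\<beta>. a \<beta> x / b \<beta> m) \<longlongrightarrow> 0) at_top" if x: "x \<in> UNIV - M" and m: "m \<in> M" for x m
  proof -
    obtain u C where u: "u < v" "C > 0" "eventually (\<lambda>\<beta>. a \<beta> x \<le> C * exp (\<beta> * u)) at_top"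
      using escape[of x] gibbs_capacity_ratio_le[of v x _ M] x unfolding a_def by blast
    \<comment> \<open>A rate strictly between \<open>u\<close> and \<open>v\<close> makes the
      exponent \<open>\<beta> * (u - w)\<close> tend to \<open>-\<infinity>\<close>.\<close>
    obtain w where w: "u < w" "w < v" using dense u(1) by blast
    have "M - {m} \<noteq> {}" using two[of m] m by auto
    then obtain D where D: "D > 0" "eventually (\<lambda>\<beta>. b \<beta> m \<ge> D * exp (\<beta> * w)) at_top"
      using gibbs_capacity_ratio_ge[of "M - {m}" v m w] trapped[OF m] w(2) unfolding b_def by blast
    show ?thesis
    proof (rule tendsto_sandwich[of "\<lambda>_. 0"])
      show "eventually (\<lambda>\<beta>. 0 \<le> a \<beta> x / b \<beta> m) at_top"
        using eventually_gt_at_top[of 0] by eventually_elim (use a0 b0 x in auto)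
      show "eventually (\<lambda>\<beta>. a \<beta> x / b \<beta> m \<le> C / D * exp (\<beta> * (u - w))) at_top"
        using u(3) D(2) eventually_gt_at_top[of 0]
      proof eventually_elim
        case (elim \<beta>)
        have "a \<beta> x / b \<beta> m \<le> C * exp (\<beta> * u) / (D * exp (\<beta> * w))"
          using elim u(2) D(1) a0[of \<beta> x] x by (intro frac_le) auto
        also have "\<dots> = C / D * exp (\<beta> * (u - w))"
          by (simp add: exp_diff algebra_simps)
        finally show ?case .
      qed
      have "filterlim (\<lambda>\<beta>. \<beta> * (u - w)) at_bot at_top"
        using filterlim_tendsto_neg_mult_at_bot[OF tendsto_const _ filterlim_ident, of "u - w"] w(1)
        by (simp add: mult.commute)
      then have "((\<lambda>\<beta>. exp (\<beta> * (u - w))) \<longlongrightarrow> 0) at_top"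
        by (rule filterlim_compose[OF exp_at_bot])
      then show "((\<lambda>\<beta>. C / D * exp (\<beta> * (u - w))) \<longlongrightarrow> 0) at_top"
        by (rule tendsto_mult_right_zero)
    qed simp
  qed
  then have sum0: "((\<lambda>\<beta>. \<Sum>x\<in>UNIV - M. \<Sum>m\<in>M. a \<beta> x / b \<beta> m) \<longlongrightarrow> 0) at_top"
    by (intro tendsto_null_sum) auto
  \<comment> \<open>Maximum and minimum are attained, so their quotient is one of the nonnegative
    terms of the double sum.\<close>
  have bounds: "eventually (\<lambda>\<beta>. 0 \<le> Max (a \<beta> ` (UNIV - M)) / Min (b \<beta> ` M) \<and>
      Max (a \<beta> ` (UNIV - M)) / Min (b \<beta> ` M) \<le> (\<Sum>x\<in>UNIV - M. \<Sum>m\<in>M. a \<beta> x / b \<beta> m)) at_top"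
    using eventually_gt_at_top[of 0]
  proof eventually_elim
    case (elim \<beta>)
    have "Max (a \<beta> ` (UNIV - M)) \<in> a \<beta> ` (UNIV - M)" using ne by (intro Max_in) auto
    then obtain x where x: "x \<in> UNIV - M" "Max (a \<beta> ` (UNIV - M)) = a \<beta> x" by blast
    have "Min (b \<beta> ` M) \<in> b \<beta> ` M" using ne by (intro Min_in) auto
    then obtain m where m: "m \<in> M" "Min (b \<beta> ` M) = b \<beta> m" by blast
    have nn: "0 \<le> a \<beta> y / b \<beta> z" if "y \<in> UNIV - M" for y z
      using a0 b0 elim that by auto
    have "a \<beta> x / b \<beta> m \<le> (\<Sum>m\<in>M. a \<beta> x / b \<beta> m)"
      by (rule member_le_sum) (use m nn x in auto)
    also have "\<dots> \<le> (\<Sum>x\<in>UNIV - M. \<Sum>m\<in>M. a \<beta> x / b \<beta> m)"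
      by (rule member_le_sum[of x "UNIV - M" "\<lambda>x. \<Sum>m\<in>M. a \<beta> x / b \<beta> m"])
        (use nn x in \<open>auto intro!: sum_nonneg\<close>)
    finally show ?case using x m nn by simp
  qed
  have "((\<lambda>\<beta>. Max (a \<beta> ` (UNIV - M)) / Min (b \<beta> ` M)) \<longlongrightarrow> 0) at_top"
    by (rule tendsto_sandwich[OF _ _ tendsto_const sum0]) (use bounds in \<open>auto elim: eventually_mono\<close>)
  then show ?thesis unfolding pta_metastable_def a_def b_def .
qed

end

section \<open>Application to the landscape with a plateau of metastable states\<close>

theorem theorem2p8:
  fixes P :: "real \<Rightarrow> 'a::finite \<Rightarrow> 'a \<Rightarrow> real"
    and \<Delta> :: "'a \<Rightarrow> 'a \<Rightarrow> ereal"
    and G :: "real \<Rightarrow> 'a \<Rightarrow> real"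
    and H :: "'a \<Rightarrow> real"
    and n :: nat
    and x0 x2 :: 'a
    and x1 :: "nat \<Rightarrow> 'a"
  assumes "\<And>x y. 0 \<le> \<Delta> x y"
    and "irreducible_rate \<Delta>"
    and "\<And>\<beta>. \<beta> > 0 \<Longrightarrow> stochastic_matrix (P \<beta>)"
    and "\<And>x y. ((\<lambda>\<beta>. log_rate \<beta> (P \<beta> x y)) \<longlongrightarrow> \<Delta> x y) at_top"
    and "\<And>\<beta> x y. \<beta> > 0 \<Longrightarrow> P \<beta> x y * exp (- \<beta> * G \<beta> x) = P \<beta> y x * exp (- \<beta> * G \<beta> y)"
    and "\<And>x. ((\<lambda>\<beta>. G \<beta> x) \<longlongrightarrow> H x) at_top"
    and "n \<ge> 2"
    and "inj_on x1 {1..n}"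
    and "x0 \<notin> x1 ` {1..n}" and "x2 \<notin> x1 ` {1..n}" and "x0 \<noteq> x2"
    and "stable_states H = {x0}"
    and "metastable_states H \<Delta> = x1 ` {1..n} \<union> {x2}"
    and "\<And>r. r \<in> {1..n} \<Longrightarrow> H x2 > H (x1 r)"
    and "\<And>r q. r \<in> {1..n} \<Longrightarrow> q \<in> {1..n} \<Longrightarrow> H (x1 r) = H (x1 q)"
    and "\<And>r q. r \<in> {1..n} \<Longrightarrow> q \<in> {1..n} \<Longrightarrow>
           comm_height H \<Delta> (x1 r) (x1 q) - ereal (H (x1 r)) < max_stability_level H \<Delta>"
  shows "\<forall>r\<in>{1..n}. pta_metastable G P {x0, x1 r, x2}"
proof
  fix r assume r: "r \<in> {1..n}"
  interpret low_temperature_chain P \<Delta> G H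
    by unfold_locales (fact assms(1-6))+
  let ?M = "{x0, x1 r, x2}"
  have x0_less: "H x0 < H x" if "x \<noteq> x0" for x
  proof -
    have "x \<notin> stable_states H" "x0 \<in> stable_states H" using assms(12) that by auto
    then show ?thesis unfolding stable_states_def by (auto simp: not_le intro: le_less_trans)
  qed
  then have lower: "lower_states H x \<noteq> {}" if "x \<noteq> x0" for x
    using that by (auto simp: lower_states_def)
  have level: "stability_level H \<Delta> x = max_stability_level H \<Delta> \<longleftrightarrow> x \<in> x1 ` {1..n} \<union> {x2}" for x
    using assms(13) by (auto simp: metastable_states_def)
  \<comment> \<open>Irreducibility joins \<open>x2\<close> to the lower state \<open>x0\<close> at
    finite height.\<close>
  have "stability_level H \<Delta> x2 < \<infinity>"
  proof -
    have "comm_height H \<Delta> x2 x0 < \<infinity>"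
      using irreducible_rate_reach[OF irreducible] assms(11) reach_imp_comm_height_less by metis
    moreover have "comm_height_sets H \<Delta> {x2} (lower_states H x2) \<le> comm_height H \<Delta> x2 x0"
      using x0_less[of x2] assms(11) by (auto simp: comm_height_sets_def lower_states_def intro: INF_lower)
    ultimately have "comm_height_sets H \<Delta> {x2} (lower_states H x2) < \<infinity>"
      by (metis le_less_trans)
    then show ?thesis using lower[of x2] assms(11)
      by (cases "comm_height_sets H \<Delta> {x2} (lower_states H x2)") (auto simp: stability_level_def)
  qed
  \<comment> \<open>The level of \<open>x2\<close> bounds the maximum above; the strict plateau
    inequality with both indices equal to \<open>r\<close> excludes
    \<open>-\<infinity>\<close>.\<close>
  then obtain v where v: "max_stability_level H \<Delta> = ereal v"
    using assms(16)[OF r r] level[of x2] by (cases "max_stability_level H \<Delta>") auto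
  have bottom: "\<not> reach (v + H x) x y" if "x \<in> x1 ` {1..n} \<union> {x2}" "H y < H x" for x y
  proof -
    have "x \<noteq> x0" using that(1) assms(9,11) by auto
    then show ?thesis
      using stability_level_less_iff[OF lower, of x \<Delta> v] level[of x] that v by auto
  qed
  have descend: "\<exists>y. H y < H x \<and> reach (v + H x) x y" if "x \<notin> x1 ` {1..n} \<union> {x2}" "x \<noteq> x0" for x
  proof -
    have "stability_level H \<Delta> x \<le> max_stability_level H \<Delta>"
      unfolding max_stability_level_def using that(2) assms(12) by (intro Max_ge) auto
    moreover have "stability_level H \<Delta> x \<noteq> max_stability_level H \<Delta>" using level that(1) by blast
    ultimately show ?thesis
      using stability_level_less_iff[OF lower, of x \<Delta> v] that(2) v by (simp add: less_le)
  qed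
  have plateau: "reach (v + H (x1 q)) (x1 q) (x1 r)" if "q \<in> {1..n}" for q
  proof (rule comm_height_less_imp_reach)
    show "comm_height H \<Delta> (x1 q) (x1 r) < ereal (v + H (x1 q))"
      using assms(16)[OF that r] v by (cases "comm_height H \<Delta> (x1 q) (x1 r)") auto
  qed
  have escape: "\<exists>m\<in>?M. reach (v + H x) x m" for x
  \<comment> \<open>Counting strictly lower states turns descent in the real-valued \<open>H\<close>
    into a well-founded induction. Going down also lowers the level \<open>v + H y\<close>, so the
    later walk stays below \<open>v + H x\<close>.\<close>
  proof (induction "card (lower_states H x)" arbitrary: x rule: less_induct)
    case less
    show ?case
    proof (cases "x \<in> x1 ` {1..n} \<union> {x2, x0}")
      case True
      then show ?thesis using plateau by blast
    next
      case False
      then obtain y where y: "H y < H x" "reach (v + H x) x y" using descend[of x] by blast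
      then have "lower_states H y \<subset> lower_states H x" by (auto simp: lower_states_def)
      then have "card (lower_states H y) < card (lower_states H x)" by (simp add: psubset_card_mono)
      then obtain m where m: "m \<in> ?M" "reach (v + H y) y m" using less by blast
      have "reach (v + H x) y m" using m(2) by (rule reach_mono) (use y(1) in simp)
      then show ?thesis using y(2) m(1) by (meson rtranclp_trans)
    qed
  qed
  have "x1 r \<noteq> x0" using assms(9) r by blast
  then have x1_x0: "H x0 < H (x1 r)" and x1_x2: "H (x1 r) < H x2"
    using x0_less assms(14)[OF r] by auto
  have trapped: "\<not> reach (v + H x) x m" if "x \<in> ?M" "m \<in> ?M" "m \<noteq> x" for x m
  proof (cases "H m < H x")
    case True
    then have "x \<noteq> x0" using x0_less[of m] by force
    then show ?thesis using bottom[of x m] that(1) r True by blast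
  next
    case False
    \<comment> \<open>The three energies are distinct, so here \<open>m\<close> is the higher state.
      A walk from \<open>x\<close> to \<open>m\<close> would reverse to one from \<open>m\<close> to
      \<open>x\<close> below \<open>v + H m\<close>, against the stability level of
      \<open>m\<close>.\<close>
    then have less: "H x < H m" using that x1_x0 x1_x2 by auto
    then have "m \<noteq> x0" using x0_less[of x] by force
    then have "\<not> reach (v + H m) m x" using bottom[of m x] that(2) r less by blast
    moreover have "reach (v + H m) m x" if "reach (v + H x) x m"
      using reach_mono[OF reach_sym[OF that], of "ereal (v + H m)"] less by simp
    ultimately show ?thesis by blast
  qed
  \<comment> \<open>Since \<open>n \<ge> 2\<close>, a second plateau state exists, and it lies
    outside the candidate set.\<close>
  obtain q where q: "q \<in> {1..n}" "q \<noteq> r"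
  proof (cases "r = 1")
    case True
    then show ?thesis using that[of 2] assms(7) by simp
  next
    case False
    then show ?thesis using that[of 1] assms(7) by simp
  qed
  then have "x1 q \<notin> ?M" using assms(8,9,10) r by (auto dest: inj_onD)
  then have proper: "?M \<noteq> UNIV" by blast
  show "pta_metastable G P ?M"
  proof (rule pta_metastable_if_barriers[OF escape trapped proper])
    show "?M \<noteq> {x}" for x using assms(11) by auto
  qed
qed

end
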